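(* Let $E$ be a Banach space, $U\subset E$ an open set containing the point $x_0$, $\mathbf S$ a $c^1$ submanifold in $U$, and $f:U\to(-\infty,\infty)$ a $c^1$ map. If $x_0\in U\cap\mathbf S$ is an extreme point of $f$ under the constraint of the submanifold $\mathbf S$ (i.e. a local maximum or minimum point of $f|_{\mathbf S}$), then $N(f'(x_0))\supset T_{x_0}\mathbf S$, that is, $f'(x_0)T_{x_0}\mathbf S=0$.
   Context: $N(\cdot)$ denotes the null space and $f'$ the Fréchet derivative. $\mathbf S\subset U$ is a $c^1$ submanifold if for each $x\in\mathbf S$ there are a closed subspace $E_0$ of $E$ having a closed complement, a neighborhood $U_0$ of $x$, and a $c^1$ diffeomorphism $\varphi$ of $U_0$ onto an open set $\varphi(U_0)\subset E$ such that $\varphi(\mathbf S\cap U_0)$ is an open set in $E_0$. The tangent space is $T_x\mathbf S=\{\dot c(0): c:(-\delta,\delta)\to\mathbf S\text{ a }c^1\text{ curve with }c(0)=x,\ \delta>0\}$. *)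

theory Defs
  imports "HOL-Analysis.Analysis"
begin

(* Continuity of the derivative is with respect to the operator norm, hence the type of bounded
   linear maps.  Used for open W only. *)
definition c1_map_on :: "'a::real_normed_vector set \<Rightarrow> ('a \<Rightarrow> 'b::real_normed_vector) \<Rightarrow> bool" where
  "c1_map_on W g \<longleftrightarrow>
     (\<exists>g' :: 'a \<Rightarrow> 'a \<Rightarrow>\<^sub>L 'b.
        (\<forall>x\<in>W. (g has_derivative blinfun_apply (g' x)) (at x)) \<and> continuous_on W g')"

definition c1_diffeomorphism_on ::
    "'a::real_normed_vector set \<Rightarrow> ('a \<Rightarrow> 'b::real_normed_vector) \<Rightarrow> bool" where
  "c1_diffeomorphism_on W \<phi> \<longleftrightarrow>
     open W \<and> open (\<phi> ` W) \<and> c1_map_on W \<phi> \<and>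
     (\<exists>\<psi>. c1_map_on (\<phi> ` W) \<psi> \<and> (\<forall>x\<in>W. \<psi> (\<phi> x) = x))"

definition closed_complemented_subspace :: "'a::real_normed_vector set \<Rightarrow> bool" where
  "closed_complemented_subspace E0 \<longleftrightarrow>
     subspace E0 \<and> closed E0 \<and>
     (\<exists>E1. subspace E1 \<and> closed E1 \<and> E0 \<inter> E1 = {0} \<and> {u + v |u v. u \<in> E0 \<and> v \<in> E1} = UNIV)"

(* The model space E0 may depend on the point x.  The chart domain need not lie in U; since
   S \<subseteq> U, it can always be shrunk to its intersection with the open set U. *)
definition c1_submanifold :: "'a::banach set \<Rightarrow> 'a set \<Rightarrow> bool" where
  "c1_submanifold U S \<longleftrightarrow>
     S \<subseteq> U \<and>
     (\<forall>x\<in>S. \<exists>E0 U0 \<phi>.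
        closed_complemented_subspace E0 \<and> x \<in> U0 \<and>
        c1_diffeomorphism_on U0 (\<phi> :: 'a \<Rightarrow> 'a) \<and>
        openin (top_of_set E0) (\<phi> ` (S \<inter> U0)))"

definition tangent_space :: "'a::real_normed_vector set \<Rightarrow> 'a \<Rightarrow> 'a set" where
  "tangent_space S x =
     {vector_derivative c (at 0) |c.
        \<exists>\<delta>>0. c C1_differentiable_on {-\<delta><..<\<delta>} \<and> c ` {-\<delta><..<\<delta>} \<subseteq> S \<and> c 0 = x}"

definition null_space :: "('a::zero \<Rightarrow> 'b::zero) \<Rightarrow> 'a set" where
  "null_space T = {v. T v = 0}"

definition local_max_on :: "('a::topological_space \<Rightarrow> real) \<Rightarrow> 'a set \<Rightarrow> 'a \<Rightarrow> bool" where
  "local_max_on f S x \<longleftrightarrow> x \<in> S \<and> (\<exists>V. open V \<and> x \<in> V \<and> (\<forall>y\<in>S \<inter> V. f y \<le> f x))"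

definition local_min_on :: "('a::topological_space \<Rightarrow> real) \<Rightarrow> 'a set \<Rightarrow> 'a \<Rightarrow> bool" where
  "local_min_on f S x \<longleftrightarrow> x \<in> S \<and> (\<exists>V. open V \<and> x \<in> V \<and> (\<forall>y\<in>S \<inter> V. f x \<le> f y))"

end

theory Submission
  imports Defs
begin

text \<open>
  A tangent vector of \<open>S\<close> at \<open>x0\<close> is the velocity of a curve that stays in \<open>S\<close>, so a constrained
  extremum of \<open>f\<close> becomes, along that curve, an unconstrained extremum of a real function of one
  real variable. By Fermat's criterion the derivative of that function vanishes at \<open>0\<close>, and by the
  chain rule this derivative is \<open>f' x0\<close> applied to the velocity; this is
  \<open>derivative_vanishes_along_curve\<close>. The image of the tangent space is all of \<open>{0}\<close>, not merely
  contained in it, because the constant curve makes \<open>0\<close> a tangent vector.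
\<close>

lemma derivative_vanishes_along_curve:
  fixes f :: "'a::real_normed_vector \<Rightarrow> real" and c :: "real \<Rightarrow> 'a"
  assumes f: "(f has_derivative f') (at x)"
    and c: "(c has_vector_derivative v) (at 0)" "c 0 = x"
    and curve: "\<delta> > 0" "c ` {-\<delta><..<\<delta>} \<subseteq> S"
    and ext: "local_max_on f S x \<or> local_min_on f S x"
  shows "f' v = 0"
proof -
  obtain V where V: "open V" "x \<in> V"
    and extV: "(\<forall>y\<in>S \<inter> V. f y \<le> f x) \<or> (\<forall>y\<in>S \<inter> V. f x \<le> f y)"
    using ext unfolding local_max_on_def local_min_on_def by blast
  have "isCont c 0"
    using c(1) by (rule has_vector_derivative_continuous)
  then have "\<exists>W. open W \<and> 0 \<in> W \<and> (\<forall>t\<in>W. c t \<in> V)"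
    unfolding continuous_at_open using V c(2) by simp
  then obtain W where W: "open W" "0 \<in> W" "\<And>t. t \<in> W \<Longrightarrow> c t \<in> V"
    by blast
  let ?I = "W \<inter> {-\<delta><..<\<delta>}"
  have "((f \<circ> c) has_derivative (f' \<circ> (\<lambda>t. t *\<^sub>R v))) (at 0)"
    using c(1) f unfolding has_vector_derivative_def c(2)[symmetric] by (rule diff_chain_at)
  moreover have "(\<forall>t\<in>?I. (f \<circ> c) t \<le> (f \<circ> c) 0) \<or> (\<forall>t\<in>?I. (f \<circ> c) 0 \<le> (f \<circ> c) t)"
  proof -
    have "\<And>t. t \<in> ?I \<Longrightarrow> c t \<in> S \<inter> V"
      using W(3) curve(2) by blast
    then show ?thesis
      using extV c(2) by auto
  qed
  moreover have "open ?I" "0 \<in> ?I"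
    using W curve(1) by auto
  ultimately have "f' \<circ> (\<lambda>t. t *\<^sub>R v) = (\<lambda>t. 0)"
    by (intro differential_zero_maxmin[of 0 ?I "f \<circ> c"]) auto
  from fun_cong[OF this, of 1] show ?thesis
    by simp
qed

lemma zero_in_tangent_space:
  assumes "x \<in> S"
  shows "0 \<in> tangent_space S x"
proof -
  have "vector_derivative (\<lambda>t::real. x) (at 0) = 0"
    by (simp add: vector_derivative_at)
  moreover have "(\<lambda>t::real. x) C1_differentiable_on {-1<..<1}"
    by simp
  ultimately show ?thesis
    unfolding tangent_space_def using assms
    by (intro CollectI exI[of _ "\<lambda>t. x"] conjI exI[of _ "1::real"]) auto
qed

theorem theorem4p4:
  fixes U S :: "'a::banach set" and x0 :: 'a and f :: "'a \<Rightarrow> real"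
  assumes "open U"
    and "x0 \<in> U \<inter> S"
    and "c1_submanifold U S"
    and "c1_map_on U f"
    and "local_max_on f S x0 \<or> local_min_on f S x0"
  shows "tangent_space S x0 \<subseteq> null_space (frechet_derivative f (at x0)) \<and>
         frechet_derivative f (at x0) ` tangent_space S x0 = {0}"
proof -
  let ?D = "frechet_derivative f (at x0)"
  have D: "(f has_derivative ?D) (at x0)"
    using assms(2,4) unfolding c1_map_on_def
    by (blast intro: frechet_derivative_works[THEN iffD1] differentiableI)
  have zero: "?D v = 0" if tangent: "v \<in> tangent_space S x0" for v
  proof -
    obtain c \<delta> where v: "v = vector_derivative c (at 0)" and \<delta>: "\<delta> > 0"
      and c: "c C1_differentiable_on {-\<delta><..<\<delta>}" "c ` {-\<delta><..<\<delta>} \<subseteq> S" "c 0 = x0"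
      using tangent unfolding tangent_space_def by blast
    have "c differentiable at 0"
      using c(1) \<delta> by (auto simp: C1_differentiable_on_eq)
    then have "(c has_vector_derivative v) (at 0)"
      unfolding v by (simp add: vector_derivative_works)
    from derivative_vanishes_along_curve[OF D this c(3) \<delta> c(2) assms(5)] show ?thesis .
  qed
  moreover have "0 \<in> tangent_space S x0"
    using assms(2) by (intro zero_in_tangent_space) blast
  ultimately show ?thesis
    unfolding null_space_def by (auto simp: image_iff intro!: bexI[of _ 0])
qed

end
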